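(* For a lattice $X$ the following conditions are equivalent: (1) $X$ is a linear lattice of order $|X|\le 2$; (2) $\upsilon(X)$ is a lattice; (3) $\lambda(X)$ is a lattice; (4) $\varphi(X)$ is a lattice. Here $\upsilon(X)$, $\lambda(X)$, $\varphi(X)$ are considered with the extensions of the two operations $\wedge,\vee$ of $X$.
   Context: A lattice is a set $X$ endowed with two semilattice operations (i.e. associative, commutative, idempotent operations) $\wedge,\vee:X\times X\to X$ such that $(x\wedge y)\vee y=y$ and $(x\vee y)\wedge y=y$ for all $x,y\in X$. A lattice is linear if $x\wedge y,\ x\vee y\in\{x,y\}$ for all $x,y\in X$. For a set $X$, an upfamily on $X$ is a non-empty family $\mathcal F$ of non-empty subsets of $X$ such that $A\in\mathcal F$ and $A\subset B\subset X$ imply $B\in\mathcal F$; $\upsilon(X)$ is the set of all upfamilies on $X$. For a family $\mathcal B$ of subsets of $X$, $\langle\mathcal B\rangle=\{A\subset X:\exists B\in\mathcal B,\ B\subset A\}$. An upfamily $\mathcal A$ is a filter if $A_1\cap A_2\in\mathcal A$ for all $A_1,A_2\in\mathcal A$; linked if $A\cap B\neq\emptyset$ for all $A,B\in\mathcal A$; maximal linked if it is linked and is not properly contained in another linked upfamily. $\varphi(X)$ and $\lambda(X)$ are the sets of all filters and of all maximal linked upfamilies on $X$, respectively. Any associative binary operation $*$ on $X$ is extended to an associative operation on $\upsilon(X)$ by $\mathcal U*\mathcal V=\big\langle\bigcup_{x\in U}x*V_x: U\in\mathcal U,\ (V_x)_{x\in U}\in\mathcal V^U\big\rangle$, where $x*V=\{x*v:v\in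 V\}$; $\varphi(X)$ and $\lambda(X)$ are closed under this extended operation. For a lattice $X$ this is applied to both $*=\wedge$ and $*=\vee$, and "$\upsilon(X)$ is a lattice" means that the two extended operations $\wedge,\vee$ on $\upsilon(X)$ are semilattice operations (i.e. associative, commutative, idempotent) such that $(\mathcal A\wedge\mathcal B)\vee\mathcal B=\mathcal B$ and $(\mathcal A\vee\mathcal B)\wedge\mathcal B=\mathcal B$ for all $\mathcal A,\mathcal B\in\upsilon(X)$ (similarly for $\lambda(X)$ and $\varphi(X)$ with the restricted operations). *)

theory Defs
  imports "HOL-Library.FuncSet"
begin

text \<open>Lattices live on a carrier set rather than on a type, so that one notion applies both to
  \<open>X\<close> and to its spaces of upfamilies; an operation on \<open>X\<close> must map \<open>X \<times> X\<close> into \<open>X\<close>.\<close>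

definition semilattice_op_on :: "'a set \<Rightarrow> ('a \<Rightarrow> 'a \<Rightarrow> 'a) \<Rightarrow> bool" where
  "semilattice_op_on X f \<longleftrightarrow>
     (\<forall>x\<in>X. \<forall>y\<in>X. f x y \<in> X) \<and>
     (\<forall>x\<in>X. \<forall>y\<in>X. \<forall>z\<in>X. f (f x y) z = f x (f y z)) \<and>
     (\<forall>x\<in>X. \<forall>y\<in>X. f x y = f y x) \<and>
     (\<forall>x\<in>X. f x x = x)"

definition lattice_on :: "'a set \<Rightarrow> ('a \<Rightarrow> 'a \<Rightarrow> 'a) \<Rightarrow> ('a \<Rightarrow> 'a \<Rightarrow> 'a) \<Rightarrow> bool" where
  "lattice_on X meet join \<longleftrightarrow>
     semilattice_op_on X meet \<and> semilattice_op_on X join \<and>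
     (\<forall>x\<in>X. \<forall>y\<in>X. join (meet x y) y = y \<and> meet (join x y) y = y)"

definition linear_lattice_on :: "'a set \<Rightarrow> ('a \<Rightarrow> 'a \<Rightarrow> 'a) \<Rightarrow> ('a \<Rightarrow> 'a \<Rightarrow> 'a) \<Rightarrow> bool" where
  "linear_lattice_on X meet join \<longleftrightarrow>
     lattice_on X meet join \<and>
     (\<forall>x\<in>X. \<forall>y\<in>X. meet x y \<in> {x, y} \<and> join x y \<in> {x, y})"

definition upfamilies :: "'a set \<Rightarrow> 'a set set set" where
  "upfamilies X =
     {F. F \<noteq> {} \<and> F \<subseteq> Pow X \<and> {} \<notin> F \<and>
         (\<forall>A\<in>F. \<forall>B. A \<subseteq> B \<and> B \<subseteq> X \<longrightarrow> B \<in> F)}"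

definition filters_on :: "'a set \<Rightarrow> 'a set set set" where
  "filters_on X = {F \<in> upfamilies X. \<forall>A\<in>F. \<forall>B\<in>F. A \<inter> B \<in> F}"

definition linked_upfamilies :: "'a set \<Rightarrow> 'a set set set" where
  "linked_upfamilies X = {F \<in> upfamilies X. \<forall>A\<in>F. \<forall>B\<in>F. A \<inter> B \<noteq> {}}"

definition max_linked_upfamilies :: "'a set \<Rightarrow> 'a set set set" where
  "max_linked_upfamilies X =
     {F \<in> linked_upfamilies X. \<not> (\<exists>G\<in>linked_upfamilies X. F \<subset> G)}"

definition up_closure :: "'a set \<Rightarrow> 'a set set \<Rightarrow> 'a set set" where
  "up_closure X \<B> = {A. A \<subseteq> X \<and> (\<exists>B\<in>\<B>. B \<subseteq> A)}"

text \<open>The family \<open>(V\<^sub>x)\<close> indexed by \<open>U\<close> is a total function whose values off \<open>U\<close> are irrelevant.\<close>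

definition ext_op ::
    "'a set \<Rightarrow> ('a \<Rightarrow> 'a \<Rightarrow> 'a) \<Rightarrow> 'a set set \<Rightarrow> 'a set set \<Rightarrow> 'a set set" where
  "ext_op X f \<U> \<V> =
     up_closure X {(\<Union>x\<in>U. f x ` V x) | U V. U \<in> \<U> \<and> V \<in> U \<rightarrow> \<V>}"

end

theory Submission
  imports Defs
begin

text \<open>
  Everything turns on three-element chains. A lattice \<open>X\<close> contains no chain \<open>a < b < c\<close> exactly when
  it is linear with at most two elements: if \<open>x, y\<close> are incomparable, then
  \<open>x \<and> y < x < x \<or> y\<close> is such a chain (lemma \<open>three_chain_exists\<close>).

  A chain \<open>a < b < c\<close> destroys the absorption law \<open>(\<B> \<and> \<A>) \<or> \<A> = \<A>\<close>, where \<open>\<B>\<close> is the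
  principal ultrafilter at \<open>b\<close>. Among the maximal linked upfamilies, the witness is the majority
  family \<open>\<A>\<close> of all sets containing at least two of \<open>a, b, c\<close>: the left-hand side contains \<open>{b}\<close>.
  Among the filters, it is the filter \<open>\<A>\<close> generated by \<open>{a, c}\<close>: every member of the left-hand
  side contains \<open>b\<close>. Either witness lies in \<open>\<upsilon>(X)\<close>.

  Conversely, if \<open>X = {p, q}\<close> with \<open>p \<le> q\<close>, an upfamily \<open>\<F>\<close> is determined by the pair of truth
  values \<open>({p} \<in> \<F>, {q} \<in> \<F>)\<close>. In these coordinates the extended meet is (or, and) and the
  extended join is (and, or), so the lattice laws are those of two copies of the Boolean
  lattice, one of them reversed. The filters and the maximal linked upfamilies inherit the laws
  because they are closed under the extension of any operation on \<open>X\<close>.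

  Both halves rest on a description of the extended operation familiar from ultrafilters,
  lemma \<open>ext_op_iff\<close>: \<open>A \<in> \<U> * \<V>\<close> iff for \<open>\<U>\<close>-many \<open>x\<close>, for \<open>\<V>\<close>-many \<open>y\<close>, \<open>x * y \<in> A\<close>.
\<close>

section \<open>Extending an operation to upfamilies\<close>

lemma upfamilies_mono:
  "F \<in> upfamilies X \<Longrightarrow> A \<in> F \<Longrightarrow> A \<subseteq> B \<Longrightarrow> B \<subseteq> X \<Longrightarrow> B \<in> F"
  unfolding upfamilies_def by blast

lemma upfamilies_subset: "F \<in> upfamilies X \<Longrightarrow> A \<in> F \<Longrightarrow> A \<subseteq> X"
  unfolding upfamilies_def by blast

lemma upfamilies_empty: "F \<in> upfamilies X \<Longrightarrow> {} \<notin> F"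
  unfolding upfamilies_def by blast

lemma upfamilies_top:
  assumes "F \<in> upfamilies X" shows "X \<in> F"
proof -
  obtain A where "A \<in> F" using assms unfolding upfamilies_def by blast
  then show ?thesis using assms upfamilies_mono upfamilies_subset by blast
qed

lemma upfamiliesI:
  assumes "X \<in> F" "{} \<notin> F" "\<And>A. A \<in> F \<Longrightarrow> A \<subseteq> X"
    and "\<And>A B. A \<in> F \<Longrightarrow> A \<subseteq> B \<Longrightarrow> B \<subseteq> X \<Longrightarrow> B \<in> F"
  shows "F \<in> upfamilies X"
  unfolding upfamilies_def using assms by blast

text \<open>Monotonicity of \<open>\<U>\<close> and \<open>\<V>\<close> lets one replace \<open>U\<close> and every \<open>V\<^sub>x\<close> by the largest sets
  that could serve, which removes the choice of a family \<open>(V\<^sub>x)\<close>.\<close>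

lemma ext_op_iff:
  assumes "\<U> \<in> upfamilies X" "\<V> \<in> upfamilies X"
  shows "A \<in> ext_op X f \<U> \<V> \<longleftrightarrow> A \<subseteq> X \<and> {x\<in>X. {y\<in>X. f x y \<in> A} \<in> \<V>} \<in> \<U>"
    (is "?L \<longleftrightarrow> A \<subseteq> X \<and> ?S \<in> \<U>")
proof
  assume ?L
  then obtain U V where UV: "A \<subseteq> X" "U \<in> \<U>" "V \<in> U \<rightarrow> \<V>" "(\<Union>x\<in>U. f x ` V x) \<subseteq> A"
    unfolding ext_op_def up_closure_def by blast
  have "U \<subseteq> ?S"
  proof
    fix x assume x: "x \<in> U"
    then have V: "V x \<in> \<V>" using UV(3) by blast
    have "V x \<subseteq> {y\<in>X. f x y \<in> A}"
      using UV(4) x upfamilies_subset[OF assms(2) V] by blast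
    then have "{y\<in>X. f x y \<in> A} \<in> \<V>"
      using upfamilies_mono[OF assms(2) V] by blast
    then show "x \<in> ?S" using x upfamilies_subset[OF assms(1) UV(2)] by blast
  qed
  then show "A \<subseteq> X \<and> ?S \<in> \<U>"
    using upfamilies_mono[OF assms(1) UV(2)] UV(1) by blast
next
  assume R: "A \<subseteq> X \<and> ?S \<in> \<U>"
  let ?V = "\<lambda>x. {y\<in>X. f x y \<in> A}"
  let ?W = "\<Union>x\<in>?S. f x ` ?V x"
  have "?V \<in> ?S \<rightarrow> \<V>" "?W \<subseteq> A" by auto
  then have "?W \<in> {(\<Union>x\<in>U. f x ` V x) | U V. U \<in> \<U> \<and> V \<in> U \<rightarrow> \<V>}"
    using R by (intro CollectI exI[of _ ?S] exI[of _ ?V]) simp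
  with \<open>?W \<subseteq> A\<close> R show ?L
    unfolding ext_op_def up_closure_def by (intro CollectI conjI bexI[of _ ?W]) simp_all
qed

lemma up_closure_mono:
  "A \<in> up_closure X \<B> \<Longrightarrow> A \<subseteq> B \<Longrightarrow> B \<subseteq> X \<Longrightarrow> B \<in> up_closure X \<B>"
  unfolding up_closure_def by blast

lemma ext_op_upfamilies:
  assumes "\<U> \<in> upfamilies X" "\<V> \<in> upfamilies X"
    and closed: "\<And>x y. x \<in> X \<Longrightarrow> y \<in> X \<Longrightarrow> f x y \<in> X"
  shows "ext_op X f \<U> \<V> \<in> upfamilies X"
proof (rule upfamiliesI)
  have "{y\<in>X. f x y \<in> X} = X" if "x \<in> X" for x using closed that by blast
  then have "{x\<in>X. {y\<in>X. f x y \<in> X} \<in> \<V>} = X"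
    using upfamilies_top[OF assms(2)] by auto
  then show "X \<in> ext_op X f \<U> \<V>"
    using ext_op_iff[OF assms(1,2)] upfamilies_top[OF assms(1)] by simp
  show "{} \<notin> ext_op X f \<U> \<V>"
    using ext_op_iff[OF assms(1,2)] upfamilies_empty[OF assms(1)] upfamilies_empty[OF assms(2)]
    by simp
  show "A \<subseteq> X" if "A \<in> ext_op X f \<U> \<V>" for A
    using that ext_op_iff[OF assms(1,2)] by blast
  show "B \<in> ext_op X f \<U> \<V>" if "A \<in> ext_op X f \<U> \<V>" "A \<subseteq> B" "B \<subseteq> X" for A B
    using that unfolding ext_op_def by (rule up_closure_mono)
qed

section \<open>Filters and maximal linked upfamilies\<close>

lemma ext_op_filters:
  assumes F: "\<U> \<in> filters_on X" "\<V> \<in> filters_on X"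
    and closed: "\<And>x y. x \<in> X \<Longrightarrow> y \<in> X \<Longrightarrow> f x y \<in> X"
  shows "ext_op X f \<U> \<V> \<in> filters_on X"
proof -
  have up: "\<U> \<in> upfamilies X" "\<V> \<in> upfamilies X"
    using F unfolding filters_on_def by auto
  have "A \<inter> B \<in> ext_op X f \<U> \<V>"
    if "A \<in> ext_op X f \<U> \<V>" "B \<in> ext_op X f \<U> \<V>" for A B
  proof -
    let ?Y = "\<lambda>A x. {y\<in>X. f x y \<in> A}"
    let ?S = "\<lambda>A. {x\<in>X. ?Y A x \<in> \<V>}"
    have AB: "A \<subseteq> X" "?S A \<in> \<U>" "?S B \<in> \<U>" using that ext_op_iff[OF up] by blast+
    have "?Y A x \<inter> ?Y B x = ?Y (A \<inter> B) x" for x by blast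
    then have "?S A \<inter> ?S B \<subseteq> ?S (A \<inter> B)"
      using F(2) unfolding filters_on_def by force
    moreover have "?S A \<inter> ?S B \<in> \<U>" using AB F(1) unfolding filters_on_def by blast
    ultimately have "?S (A \<inter> B) \<in> \<U>" using upfamilies_mono[OF up(1)] by blast
    then show ?thesis using ext_op_iff[OF up] AB by blast
  qed
  moreover have "ext_op X f \<U> \<V> \<in> upfamilies X"
    using closed by (rule ext_op_upfamilies[OF up])
  ultimately show ?thesis unfolding filters_on_def by blast
qed

text \<open>Like an ultrafilter, a maximal linked upfamily decides every set: if \<open>A \<notin> \<F>\<close>, then the
  supersets of \<open>A\<close> cannot be added to \<open>\<F>\<close>, so \<open>A\<close> misses some member of \<open>\<F>\<close>. This
  criterion makes maximality easy both to verify and to transport.\<close>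

lemma max_linked_iff:
  "F \<in> max_linked_upfamilies X \<longleftrightarrow>
     F \<in> linked_upfamilies X \<and> (\<forall>A. A \<subseteq> X \<longrightarrow> A \<in> F \<or> X - A \<in> F)"
proof (intro iffI conjI allI impI)
  assume F: "F \<in> max_linked_upfamilies X"
  then show L: "F \<in> linked_upfamilies X" unfolding max_linked_upfamilies_def by blast
  then have up: "F \<in> upfamilies X" unfolding linked_upfamilies_def by blast
  fix A assume A: "A \<subseteq> X"
  show "A \<in> F \<or> X - A \<in> F"
  proof (rule ccontr)
    assume no: "\<not> (A \<in> F \<or> X - A \<in> F)"
    have meets: "B \<inter> A \<noteq> {}" if "B \<in> F" for B
    proof
      assume "B \<inter> A = {}"
      then have "B \<subseteq> X - A" using upfamilies_subset[OF up that] by blast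
      then show False using no upfamilies_mono[OF up that] by blast
    qed
    let ?G = "F \<union> {B. A \<subseteq> B \<and> B \<subseteq> X}"
    have ne: "A \<noteq> {}" using meets[OF upfamilies_top[OF up]] by blast
    have "?G \<in> upfamilies X"
    proof (rule upfamiliesI)
      show "X \<in> ?G" using upfamilies_top[OF up] by blast
      show "{} \<notin> ?G" using ne upfamilies_empty[OF up] by blast
      show "B \<subseteq> X" if "B \<in> ?G" for B using that upfamilies_subset[OF up] by blast
      show "C \<in> ?G" if "B \<in> ?G" "B \<subseteq> C" "C \<subseteq> X" for B C
        using that upfamilies_mono[OF up, of B C] by blast
    qed
    moreover have "B \<inter> C \<noteq> {}" if B: "B \<in> ?G" and C: "C \<in> ?G" for B C
    proof -
      consider "B \<in> F" "C \<in> F" | "B \<in> F" "A \<subseteq> C" | "A \<subseteq> B" "C \<in> F" | "A \<subseteq> B" "A \<subseteq> C"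
        using B C by blast
      then show ?thesis
      proof cases
        case 1 then show ?thesis using L unfolding linked_upfamilies_def by blast
      next
        case 2 then show ?thesis using meets[of B] by blast
      next
        case 3 then show ?thesis using meets[of C] by blast
      next
        case 4 then show ?thesis using ne by blast
      qed
    qed
    ultimately have "?G \<in> linked_upfamilies X" unfolding linked_upfamilies_def by blast
    moreover have "F \<subset> ?G" using no A by blast
    ultimately show False using F unfolding max_linked_upfamilies_def by blast
  qed
next
  assume R: "F \<in> linked_upfamilies X \<and> (\<forall>A. A \<subseteq> X \<longrightarrow> A \<in> F \<or> X - A \<in> F)"
  have False if G: "G \<in> linked_upfamilies X" "F \<subset> G" for G
  proof -
    obtain A where A: "A \<in> G" "A \<notin> F" using G(2) by blast
    have "A \<subseteq> X" using A(1) G(1) upfamilies_subset unfolding linked_upfamilies_def by blast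
    then have "X - A \<in> G" using A(2) R G(2) by blast
    then have "A \<inter> (X - A) \<noteq> {}" using A(1) G(1) unfolding linked_upfamilies_def by blast
    then show False by blast
  qed
  then show "F \<in> max_linked_upfamilies X" using R unfolding max_linked_upfamilies_def by blast
qed

lemma ext_op_max_linked:
  assumes F: "\<U> \<in> max_linked_upfamilies X" "\<V> \<in> max_linked_upfamilies X"
    and closed: "\<And>x y. x \<in> X \<Longrightarrow> y \<in> X \<Longrightarrow> f x y \<in> X"
  shows "ext_op X f \<U> \<V> \<in> max_linked_upfamilies X"
proof -
  have L: "\<U> \<in> linked_upfamilies X" "\<V> \<in> linked_upfamilies X"
    and dec: "\<And>A. A \<subseteq> X \<Longrightarrow> A \<in> \<U> \<or> X - A \<in> \<U>" "\<And>A. A \<subseteq> X \<Longrightarrow> A \<in> \<V> \<or> X - A \<in> \<V>"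
    using F max_linked_iff by blast+
  then have up: "\<U> \<in> upfamilies X" "\<V> \<in> upfamilies X"
    unfolding linked_upfamilies_def by blast+
  let ?Y = "\<lambda>A x. {y\<in>X. f x y \<in> A}"
  let ?S = "\<lambda>A. {x\<in>X. ?Y A x \<in> \<V>}"
  have "A \<inter> B \<noteq> {}" if "A \<in> ext_op X f \<U> \<V>" "B \<in> ext_op X f \<U> \<V>" for A B
  proof -
    have "?S A \<in> \<U>" "?S B \<in> \<U>" using that ext_op_iff[OF up] by blast+
    then have "?S A \<inter> ?S B \<noteq> {}" using L(1) unfolding linked_upfamilies_def by blast
    then obtain x where "?Y A x \<in> \<V>" "?Y B x \<in> \<V>" by blast
    then have "?Y A x \<inter> ?Y B x \<noteq> {}" using L(2) unfolding linked_upfamilies_def by blast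
    then show ?thesis by blast
  qed
  moreover have "ext_op X f \<U> \<V> \<in> upfamilies X"
    using closed by (rule ext_op_upfamilies[OF up])
  ultimately have "ext_op X f \<U> \<V> \<in> linked_upfamilies X"
    unfolding linked_upfamilies_def by blast
  moreover have "A \<in> ext_op X f \<U> \<V> \<or> X - A \<in> ext_op X f \<U> \<V>" if A: "A \<subseteq> X" for A
  proof (cases "?S A \<in> \<U>")
    case True then show ?thesis using ext_op_iff[OF up] A by blast
  next
    case False
    then have "X - ?S A \<in> \<U>" using dec(1)[of "?S A"] by blast
    moreover have "X - ?S A \<subseteq> ?S (X - A)"
    proof
      fix x assume x: "x \<in> X - ?S A"
      then have "X - ?Y A x \<in> \<V>" using dec(2)[of "?Y A x"] by blast
      moreover have "X - ?Y A x = ?Y (X - A) x" using closed x by blast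
      ultimately show "x \<in> ?S (X - A)" using x by simp
    qed
    ultimately have "?S (X - A) \<in> \<U>" using upfamilies_mono[OF up(1)] by blast
    then show ?thesis using ext_op_iff[OF up] by blast
  qed
  ultimately show ?thesis using max_linked_iff by blast
qed

lemma max_linkedI:
  assumes "F \<in> upfamilies X" "\<And>A B. A \<in> F \<Longrightarrow> B \<in> F \<Longrightarrow> A \<inter> B \<noteq> {}"
    and "\<And>A. A \<subseteq> X \<Longrightarrow> A \<in> F \<or> X - A \<in> F"
  shows "F \<in> max_linked_upfamilies X"
  using assms unfolding max_linked_iff linked_upfamilies_def by blast

lemma principal_filter:
  assumes "A \<noteq> {}" "A \<subseteq> X"
  shows "{B. A \<subseteq> B \<and> B \<subseteq> X} \<in> filters_on X"
proof -
  have "{B. A \<subseteq> B \<and> B \<subseteq> X} \<in> upfamilies X" by (rule upfamiliesI) (use assms in auto)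
  then show ?thesis unfolding filters_on_def by auto
qed

lemma principal_max_linked:
  assumes "b \<in> X"
  shows "{B. {b} \<subseteq> B \<and> B \<subseteq> X} \<in> max_linked_upfamilies X"
proof (rule max_linkedI)
  show "{B. {b} \<subseteq> B \<and> B \<subseteq> X} \<in> upfamilies X"
    using principal_filter[of "{b}" X] assms unfolding filters_on_def by simp
qed (use assms in auto)

definition majority_family :: "'a set \<Rightarrow> 'a \<Rightarrow> 'a \<Rightarrow> 'a \<Rightarrow> 'a set set" where
  "majority_family X a b c =
     {A. A \<subseteq> X \<and> (a \<in> A \<and> b \<in> A \<or> a \<in> A \<and> c \<in> A \<or> b \<in> A \<and> c \<in> A)}"

text \<open>Two majorities among three elements overlap, and of two complementary sets one has
  the majority.\<close>

lemma majority_family_max_linked: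
  assumes "a \<in> X" "b \<in> X" "c \<in> X"
  shows "majority_family X a b c \<in> max_linked_upfamilies X"
proof (rule max_linkedI)
  show "majority_family X a b c \<in> upfamilies X"
    by (rule upfamiliesI) (use assms in \<open>auto simp: majority_family_def\<close>)
qed (use assms in \<open>auto simp: majority_family_def\<close>)

section \<open>Three-element chains\<close>

lemma lattice_onD:
  assumes "lattice_on X meet join" "x \<in> X" "y \<in> X"
  shows "meet x y \<in> X" "join x y \<in> X" "meet x y = meet y x" "join x y = join y x"
    "meet x x = x" "join x x = x" "join (meet x y) y = y" "meet (join x y) y = y"
  using assms unfolding lattice_on_def semilattice_op_on_def by blast+

lemma lattice_on_assoc:
  assumes "lattice_on X meet join" "x \<in> X" "y \<in> X" "z \<in> X"
  shows "meet (meet x y) z = meet x (meet y z)" "join (join x y) z = join x (join y z)"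
  using assms unfolding lattice_on_def semilattice_op_on_def by blast+

lemma meet_eq_iff_join_eq:
  assumes "lattice_on X meet join" "x \<in> X" "y \<in> X"
  shows "meet x y = x \<longleftrightarrow> join x y = y"
  using lattice_onD[OF assms] lattice_onD[OF assms(1,3,2)] by metis

definition three_chain :: "'a set \<Rightarrow> ('a \<Rightarrow> 'a \<Rightarrow> 'a) \<Rightarrow> 'a \<Rightarrow> 'a \<Rightarrow> 'a \<Rightarrow> bool" where
  "three_chain X meet a b c \<longleftrightarrow>
     a \<in> X \<and> b \<in> X \<and> c \<in> X \<and> meet a b = a \<and> meet b c = b \<and> a \<noteq> b \<and> b \<noteq> c"

lemma three_chain_distinct_ends:
  assumes "lattice_on X meet join" "three_chain X meet a b c"
  shows "a \<noteq> c"
  using lattice_onD(3)[OF assms(1)] assms(2) unfolding three_chain_def by metis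

text \<open>If linearity fails, the chain runs through one of two incomparable elements; if it holds,
  any three distinct elements can be sorted.\<close>

lemma three_chain_exists:
  assumes lat: "lattice_on X meet join"
    and "\<not> (linear_lattice_on X meet join \<and> finite X \<and> card X \<le> 2)"
  shows "\<exists>a b c. three_chain X meet a b c"
proof (cases "linear_lattice_on X meet join")
  case False
  then obtain x y where xy: "x \<in> X" "y \<in> X" and
    bad: "meet x y \<notin> {x, y} \<or> join x y \<notin> {x, y}"
    using lat unfolding linear_lattice_on_def by blast
  note D = lattice_onD[OF lat]
  have nle: "meet x y \<noteq> x" "meet x y \<noteq> y"
    using bad meet_eq_iff_join_eq[OF lat xy] meet_eq_iff_join_eq[OF lat xy(2,1)]
      D(3,4)[OF xy] by auto
  have "meet (meet x y) x = meet x y"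
    using lattice_on_assoc(1)[OF lat xy(1) xy(1) xy(2)] D(3)[OF xy(1) D(1)[OF xy]] D(5)[OF xy(1) xy(1)]
    by simp
  moreover have "meet x (join x y) = x"
    using D(8)[OF xy(2,1)] D(4)[OF xy] D(3)[OF xy(1) D(2)[OF xy]] by simp
  moreover have "x \<noteq> join x y"
    using nle(2) meet_eq_iff_join_eq[OF lat xy(2,1)] D(3,4)[OF xy] by auto
  ultimately have "three_chain X meet (meet x y) x (join x y)"
    unfolding three_chain_def using xy nle D(1,2)[OF xy] by simp
  then show ?thesis by blast
next
  case True
  have "\<exists>T\<subseteq>X. card T = 3"
  proof (cases "finite X")
    case fin: True
    then have "3 \<le> card X" using assms(2) True by simp
    then show ?thesis by (metis obtain_subset_with_card_n)
  next
    case False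
    then show ?thesis by (metis infinite_arbitrarily_large)
  qed
  then obtain x y z where xyz: "x \<in> X" "y \<in> X" "z \<in> X" "x \<noteq> y" "x \<noteq> z" "y \<noteq> z"
    by (auto simp: card_3_iff)
  have lin: "meet u v = u \<or> meet v u = v" if "u \<in> X" "v \<in> X" for u v
    using True that lattice_onD(3)[OF lat that] unfolding linear_lattice_on_def by auto
  have "three_chain X meet x y z \<or> three_chain X meet x z y \<or> three_chain X meet y x z
      \<or> three_chain X meet y z x \<or> three_chain X meet z x y \<or> three_chain X meet z y x"
    unfolding three_chain_def
    using xyz lin[OF xyz(1,2)] lin[OF xyz(1,3)] lin[OF xyz(2,3)] by auto
  then show ?thesis by blast
qed

section \<open>Absorption fails above a three-element chain\<close>

text \<open>Here \<open>b \<and> {b, c} = {b} = b \<or> {a, b}\<close>, and both two-element sets have the majority, so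
  that the left-hand side of the absorption law contains \<open>{b}\<close>.\<close>

lemma majority_family_not_absorbing:
  assumes lat: "lattice_on X meet join" and chain: "three_chain X meet a b c"
  defines "M \<equiv> majority_family X a b c" and "P \<equiv> {B. {b} \<subseteq> B \<and> B \<subseteq> X}"
  shows "ext_op X join (ext_op X meet P M) M \<noteq> M"
proof
  assume absorb: "ext_op X join (ext_op X meet P M) M = M"
  note ch = chain[unfolded three_chain_def]
  have join_ba: "join b a = b"
    using ch meet_eq_iff_join_eq[OF lat, of a b] lattice_onD(4)[OF lat, of a b] by simp
  have up: "M \<in> upfamilies X" "P \<in> upfamilies X"
    using majority_family_max_linked[of a X b c] principal_max_linked[of b X] ch
    unfolding M_def P_def max_linked_upfamilies_def linked_upfamilies_def by simp_all
  have up': "ext_op X meet P M \<in> upfamilies X"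
    by (rule ext_op_upfamilies[OF up(2,1)]) (use lattice_onD(1)[OF lat] in blast)
  have "{y\<in>X. meet b y \<in> {b}} \<in> M" "{y\<in>X. join b y \<in> {b}} \<in> M"
    using ch join_ba lattice_onD(5,6)[OF lat, of b b] unfolding M_def majority_family_def by auto
  then have "{x\<in>X. {y\<in>X. meet x y \<in> {b}} \<in> M} \<in> P"
    and b: "{b} \<subseteq> {x\<in>X. {y\<in>X. join x y \<in> {b}} \<in> M}"
    using ch unfolding P_def by auto
  then have "{b} \<in> ext_op X meet P M"
    using ext_op_iff[OF up(2,1), of "{b}" meet] ch by blast
  then have "{x\<in>X. {y\<in>X. join x y \<in> {b}} \<in> M} \<in> ext_op X meet P M"
    using upfamilies_mono[OF up' _ b] by blast
  then have "{b} \<in> M"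
    using ext_op_iff[OF up' up(1), of "{b}" join] ch absorb by blast
  then show False
    using ch three_chain_distinct_ends[OF lat chain] unfolding M_def majority_family_def by auto
qed

text \<open>Every member of \<open>b \<and> \<F>\<close> contains \<open>b \<and> c = b\<close>, and then every member of \<open>(b \<and> \<F>) \<or> \<F>\<close>
  contains \<open>b \<or> a = b\<close>; but \<open>{a, c} \<in> \<F>\<close>.\<close>

lemma endpoint_filter_not_absorbing:
  assumes lat: "lattice_on X meet join" and chain: "three_chain X meet a b c"
  defines "F \<equiv> {B. {a, c} \<subseteq> B \<and> B \<subseteq> X}" and "P \<equiv> {B. {b} \<subseteq> B \<and> B \<subseteq> X}"
  shows "ext_op X join (ext_op X meet P F) F \<noteq> F"
proof
  assume absorb: "ext_op X join (ext_op X meet P F) F = F"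
  note ch = chain[unfolded three_chain_def]
  have join_ba: "join b a = b"
    using ch meet_eq_iff_join_eq[OF lat, of a b] lattice_onD(4)[OF lat, of a b] by simp
  have up: "F \<in> upfamilies X" "P \<in> upfamilies X"
    using principal_filter[of "{a, c}" X] principal_filter[of "{b}" X] ch
    unfolding F_def P_def filters_on_def by simp_all
  have up': "ext_op X meet P F \<in> upfamilies X"
    by (rule ext_op_upfamilies[OF up(2,1)]) (use lattice_onD(1)[OF lat] in blast)
  have "{a, c} \<in> ext_op X join (ext_op X meet P F) F"
    unfolding absorb using ch unfolding F_def by simp
  then have "{x\<in>X. {y\<in>X. join x y \<in> {a, c}} \<in> F} \<in> ext_op X meet P F"
    using ext_op_iff[OF up' up(1)] by blast
  then have "{x\<in>X. {y\<in>X. meet x y \<in> {x\<in>X. {y\<in>X. join x y \<in> {a, c}} \<in> F}} \<in> F} \<in> P"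
    using ext_op_iff[OF up(2,1)] by blast
  then have "meet b c \<in> {x\<in>X. {y\<in>X. join x y \<in> {a, c}} \<in> F}"
    unfolding P_def F_def by auto
  then have "join b a \<in> {a, c}" using ch unfolding F_def by auto
  then show False using ch join_ba by auto
qed

lemma three_chain_not_lattice:
  assumes lat: "lattice_on X meet join" and chain: "three_chain X meet a b c"
  shows "\<not> lattice_on (upfamilies X) (ext_op X meet) (ext_op X join)"
    and "\<not> lattice_on (max_linked_upfamilies X) (ext_op X meet) (ext_op X join)"
    and "\<not> lattice_on (filters_on X) (ext_op X meet) (ext_op X join)"
proof -
  note ch = chain[unfolded three_chain_def]
  have M: "majority_family X a b c \<in> max_linked_upfamilies X"
    and P: "{B. {b} \<subseteq> B \<and> B \<subseteq> X} \<in> max_linked_upfamilies X"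
    using majority_family_max_linked[of a X b c] principal_max_linked[of b X] ch by simp_all
  show "\<not> lattice_on (max_linked_upfamilies X) (ext_op X meet) (ext_op X join)"
    using majority_family_not_absorbing[OF lat chain]
    by - (erule contrapos_nn, rule lattice_onD(7)[OF _ P M])
  have Mu: "majority_family X a b c \<in> upfamilies X"
    and Pu: "{B. {b} \<subseteq> B \<and> B \<subseteq> X} \<in> upfamilies X"
    using M P unfolding max_linked_upfamilies_def linked_upfamilies_def by blast+
  show "\<not> lattice_on (upfamilies X) (ext_op X meet) (ext_op X join)"
    using majority_family_not_absorbing[OF lat chain]
    by - (erule contrapos_nn, rule lattice_onD(7)[OF _ Pu Mu])
  have Ff: "{B. {a, c} \<subseteq> B \<and> B \<subseteq> X} \<in> filters_on X"
    and Pf: "{B. {b} \<subseteq> B \<and> B \<subseteq> X} \<in> filters_on X"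
    using principal_filter[of "{a, c}" X] principal_filter[of "{b}" X] ch by simp_all
  show "\<not> lattice_on (filters_on X) (ext_op X meet) (ext_op X join)"
    using endpoint_filter_not_absorbing[OF lat chain]
    by - (erule contrapos_nn, rule lattice_onD(7)[OF _ Pf Ff])
qed

section \<open>Two-element chains\<close>

text \<open>The degenerate case \<open>p = q\<close> is admitted throughout, so that one-element lattices need no
  separate treatment.\<close>

lemma upfamilies_pair_eqI:
  assumes "F \<in> upfamilies {p, q}" "G \<in> upfamilies {p, q}"
    and "{p} \<in> F \<longleftrightarrow> {p} \<in> G" "{q} \<in> F \<longleftrightarrow> {q} \<in> G"
  shows "F = G"
proof -
  have "A \<in> F \<longleftrightarrow> A \<in> G" for A
  proof (cases "A \<subseteq> {p, q}")
    case True
    then consider "A = {}" | "A = {p}" | "A = {q}" | "A = {p, q}" by blast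
    then show ?thesis
      using assms upfamilies_empty upfamilies_top by cases blast+
  next
    case False then show ?thesis using assms upfamilies_subset by blast
  qed
  then show ?thesis by blast
qed

text \<open>The conclusion covers meets, where \<open>p\<close> is the absorbing element, and, with the roles of
  \<open>p\<close> and \<open>q\<close> exchanged, joins. The minimum of two elements is \<open>p\<close> as soon as one of them is,
  and \<open>q\<close> only if both are.\<close>

lemma ext_op_pair:
  assumes F: "F \<in> upfamilies {p, q}" and G: "G \<in> upfamilies {p, q}"
    and f: "f p p = p" "f p q = p" "f q p = p" "f q q = q"
  shows "{p} \<in> ext_op {p, q} f F G \<longleftrightarrow> {p} \<in> F \<or> {p} \<in> G"
    and "{q} \<in> ext_op {p, q} f F G \<longleftrightarrow> {q} \<in> F \<and> {q} \<in> G"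
proof -
  note top = upfamilies_top[OF F] upfamilies_top[OF G]
  note bot = upfamilies_empty[OF F] upfamilies_empty[OF G]
  have "({p} \<in> ext_op {p, q} f F G \<longleftrightarrow> {p} \<in> F \<or> {p} \<in> G) \<and>
        ({q} \<in> ext_op {p, q} f F G \<longleftrightarrow> {q} \<in> F \<and> {q} \<in> G)"
  proof (cases "p = q")
    case True
    have "ext_op {p, q} f F G \<in> upfamilies {p, q}"
      by (rule ext_op_upfamilies[OF F G]) (use f in auto)
    then have "{p, q} \<in> ext_op {p, q} f F G" by (rule upfamilies_top)
    then show ?thesis using top True by simp
  next
    case False
    have Y: "{y\<in>{p,q}. f p y \<in> {p}} = {p,q}" "{y\<in>{p,q}. f q y \<in> {p}} = {p}"
      "{y\<in>{p,q}. f p y \<in> {q}} = {}" "{y\<in>{p,q}. f q y \<in> {q}} = {q}"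
      using f False by auto
    have pick: "{x\<in>{p,q}. P x} = (if P p then {p} else {}) \<union> (if P q then {q} else {})" for P
      by auto
    have "{x\<in>{p,q}. {y\<in>{p,q}. f x y \<in> {p}} \<in> G} = (if {p} \<in> G then {p,q} else {p})"
      unfolding pick[of "\<lambda>x. {y\<in>{p,q}. f x y \<in> {p}} \<in> G"] Y(1,2) using top(2) by auto
    moreover have "{x\<in>{p,q}. {y\<in>{p,q}. f x y \<in> {q}} \<in> G} = (if {q} \<in> G then {q} else {})"
      unfolding pick[of "\<lambda>x. {y\<in>{p,q}. f x y \<in> {q}} \<in> G"] Y(3,4) using bot(2) by auto
    ultimately show ?thesis
      using ext_op_iff[OF F G, of "{p}" f] ext_op_iff[OF F G, of "{q}" f] top bot by auto
  qed
  then show "{p} \<in> ext_op {p, q} f F G \<longleftrightarrow> {p} \<in> F \<or> {p} \<in> G"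
    and "{q} \<in> ext_op {p, q} f F G \<longleftrightarrow> {q} \<in> F \<and> {q} \<in> G" by blast+
qed

lemma upfamilies_pair_lattice:
  assumes lat: "lattice_on {p, q} meet join" and pq: "meet p q = p"
  shows "lattice_on (upfamilies {p, q}) (ext_op {p, q} meet) (ext_op {p, q} join)"
proof -
  let ?X = "{p, q}"
  note D = lattice_onD[OF lat]
  have mt: "meet p p = p" "meet p q = p" "meet q p = p" "meet q q = q"
    using D(5)[of p p] D(5)[of q q] D(3)[of p q] pq by simp_all
  have jn: "join q q = q" "join q p = q" "join p q = q" "join p p = p"
    using D(6)[of p p] D(6)[of q q] D(4)[of p q] meet_eq_iff_join_eq[OF lat, of p q] pq
    by simp_all
  have cl: "ext_op ?X meet F G \<in> upfamilies ?X" "ext_op ?X join F G \<in> upfamilies ?X"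
    if "F \<in> upfamilies ?X" "G \<in> upfamilies ?X" for F G
    using ext_op_upfamilies[OF that] D(1,2) by blast+
  note coords = ext_op_pair[of _ p q _ meet, OF _ _ mt]
    ext_op_pair[of _ q p _ join, OF _ _ jn, unfolded insert_commute[of q p "{}"]]
  show ?thesis
    unfolding lattice_on_def semilattice_op_on_def
    by (intro conjI ballI; (rule upfamilies_pair_eqI[of _ p q])?; auto simp: cl coords)
qed

lemma lattice_on_subset:
  assumes "lattice_on L f g" "K \<subseteq> L"
    and "\<And>x y. x \<in> K \<Longrightarrow> y \<in> K \<Longrightarrow> f x y \<in> K" "\<And>x y. x \<in> K \<Longrightarrow> y \<in> K \<Longrightarrow> g x y \<in> K"
  shows "lattice_on K f g"
  unfolding lattice_on_def semilattice_op_on_def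
  by (intro conjI ballI;
      rule assms(3,4) lattice_on_assoc[OF assms(1)] lattice_onD(3-8)[OF assms(1)];
      use assms(2) in blast)

lemma small_linear_lattice_cases:
  assumes lin: "linear_lattice_on X meet join" and "finite X" "card X \<le> 2"
  obtains "X = {}" | p q where "X = {p, q}" "meet p q = p"
proof -
  consider "card X = 0" | "card X = 1" | "card X = 2" using assms(3) by linarith
  then show thesis
  proof cases
    case 1 then show thesis using assms(2) that(1) by simp
  next
    case 2
    then obtain p where "X = {p}" by (auto simp: card_1_singleton_iff)
    then show thesis using lin that(2)[of p p] unfolding linear_lattice_on_def by auto
  next
    case 3
    then obtain p q where X: "X = {p, q}" by (auto simp: card_2_iff)
    then have "meet p q = p \<or> meet q p = q"
      using lin lattice_onD(3)[of X meet join p q] unfolding linear_lattice_on_def by auto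
    then show thesis using X that(2)[of p q] that(2)[of q p] by auto
  qed
qed

lemma small_linear_lattice_upfamilies:
  assumes lat: "lattice_on X meet join"
    and "linear_lattice_on X meet join" "finite X" "card X \<le> 2"
  shows "lattice_on (upfamilies X) (ext_op X meet) (ext_op X join)"
  using assms(2-4)
proof (cases rule: small_linear_lattice_cases)
  case 1
  then have "upfamilies X = {}" using upfamilies_top upfamilies_empty by blast
  then show ?thesis unfolding lattice_on_def semilattice_op_on_def by simp
next
  case (2 p q)
  then show ?thesis using upfamilies_pair_lattice[of p q meet join] lat by simp
qed

theorem theorem5p1:
  fixes X :: "'a set" and meet join :: "'a \<Rightarrow> 'a \<Rightarrow> 'a"
  assumes "lattice_on X meet join"
  shows "((linear_lattice_on X meet join \<and> finite X \<and> card X \<le> 2) \<longleftrightarrow> lattice_on (upfamilies X) (ext_op X meet) (ext_op X join))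
       \<and> ((linear_lattice_on X meet join \<and> finite X \<and> card X \<le> 2) \<longleftrightarrow> lattice_on (max_linked_upfamilies X) (ext_op X meet) (ext_op X join))
       \<and> ((linear_lattice_on X meet join \<and> finite X \<and> card X \<le> 2) \<longleftrightarrow> lattice_on (filters_on X) (ext_op X meet) (ext_op X join))"
proof (cases "linear_lattice_on X meet join \<and> finite X \<and> card X \<le> 2")
  case True
  then have up: "lattice_on (upfamilies X) (ext_op X meet) (ext_op X join)"
    using small_linear_lattice_upfamilies[OF assms] by blast
  note closed = lattice_onD(1,2)[OF assms]
  have "max_linked_upfamilies X \<subseteq> upfamilies X"
    unfolding max_linked_upfamilies_def linked_upfamilies_def by blast
  then have "lattice_on (max_linked_upfamilies X) (ext_op X meet) (ext_op X join)"
    by (rule lattice_on_subset[OF up]) (use ext_op_max_linked closed in blast)+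
  moreover have "filters_on X \<subseteq> upfamilies X"
    unfolding filters_on_def by blast
  then have "lattice_on (filters_on X) (ext_op X meet) (ext_op X join)"
    by (rule lattice_on_subset[OF up]) (use ext_op_filters closed in blast)+
  ultimately show ?thesis using True up by blast
next
  case False
  then obtain a b c where "three_chain X meet a b c"
    using three_chain_exists[OF assms] by blast
  then show ?thesis using False three_chain_not_lattice[OF assms] by blast
qed

end
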